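(* Let $r$ be a positive integer and $s$ a non-negative integer, with $r\neq 6$. Then a solution to $(4,3)$-HWP$(48;r,s)$ exists if and only if $r+s=23$.
   Context: $K_{48}-I$ denotes the complete graph on $48$ vertices with the edges of a perfect matching $I$ removed. A $C_k$-factor of a graph is a spanning subgraph each of whose components is a cycle of length $k$. A solution to $(4,3)$-HWP$(48;r,s)$ is a partition of the edge set of $K_{48}-I$, for some perfect matching $I$, into $r$ $C_4$-factors and $s$ $C_3$-factors. *)

theory Defs
  imports Main
begin

text \<open>Simple graphs on a vertex set V are represented by edge sets: sets of 2-element sets.\<close>

definition complete_edges :: "'a set \<Rightarrow> 'a set set" where
  "complete_edges V = {{u, v} | u v. u \<in> V \<and> v \<in> V \<and> u \<noteq> v}"

definition perfect_matching :: "'a set \<Rightarrow> 'a set set \<Rightarrow> bool" where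
  "perfect_matching V I \<longleftrightarrow> I \<subseteq> complete_edges V \<and> (\<forall>v\<in>V. \<exists>!e. e \<in> I \<and> v \<in> e)"

definition is_cycle_edges :: "nat \<Rightarrow> 'a set set \<Rightarrow> bool" where
  "is_cycle_edges k C \<longleftrightarrow> k \<ge> 3 \<and>
     (\<exists>f. inj_on f {..<k} \<and> C = {{f i, f (Suc i mod k)} | i. i < k})"

definition ck_factor :: "nat \<Rightarrow> 'a set \<Rightarrow> 'a set set \<Rightarrow> bool" where
  "ck_factor k V F \<longleftrightarrow>
     (\<exists>\<C>. (\<forall>C\<in>\<C>. is_cycle_edges k C) \<and> \<Union>\<C> = F \<and>
          (\<forall>C\<in>\<C>. \<forall>D\<in>\<C>. C \<noteq> D \<longrightarrow> \<Union>C \<inter> \<Union>D = {}) \<and>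
          \<Union>F = V)"

definition hwp43 :: "nat \<Rightarrow> nat \<Rightarrow> nat \<Rightarrow> bool" where
  "hwp43 n r s \<longleftrightarrow>
     (\<exists>I F. perfect_matching {..<n} I \<and>
        (\<forall>i<r. ck_factor 4 {..<n} (F i)) \<and>
        (\<forall>i. r \<le> i \<and> i < r + s \<longrightarrow> ck_factor 3 {..<n} (F i)) \<and>
        (\<forall>i<r+s. \<forall>j<r+s. i \<noteq> j \<longrightarrow> F i \<inter> F j = {}) \<and>
        (\<Union>i<r+s. F i) = complete_edges {..<n} - I)"

end

theory Submission
  imports Defs "HOL-Library.Code_Binary_Nat" "HOL-Library.Multiset"
begin

text \<open>
  Write the 48 vertices as \<open>12 g + 4 h + y\<close> with \<open>g, y < 4\<close> and \<open>h < 3\<close>. Each of the four copies of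
  \<open>K\<^sub>1\<^sub>2 - I\<close> formed by the vertices with a given \<open>g\<close> splits into \<open>r\<^sub>0\<close> \<open>C\<^sub>4\<close>-factors and \<open>5 - r\<^sub>0\<close>
  \<open>C\<^sub>3\<close>-factors, for every \<open>r\<^sub>0\<close> in \<open>{1..5}\<close>. The remaining edges form the complete multipartite graph
  of type \<open>12\<^sup>4\<close>, which is handled in two ways. It has a resolvable decomposition into 18 \<open>C\<^sub>3\<close>-factors,
  which gives \<open>r\<close> in \<open>{1..5}\<close>. Alternatively, collapse each set of four vertices with common \<open>(g, h)\<close>
  to a point: a resolvable transversal design on the \<open>4 \<times> 3\<close> grid has the rows as one of its parallel
  classes, and each of its three other classes blows up to four disjoint copies of \<open>K\<^sub>4\<^sub>,\<^sub>4\<^sub>,\<^sub>4\<close>, which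
  splits into four \<open>C\<^sub>4\<close>-factors as well as into four \<open>C\<^sub>3\<close>-factors. The edges within a
  column of the grid yield six more \<open>C\<^sub>4\<close>-factors, so this gives every \<open>r \<ge> 7\<close>.
\<close>

section \<open>Counting edges\<close>

lemma Union_cycle_edges:
  assumes "k > 0"
  shows "\<Union>{{f i, f (Suc i mod k)} | i. i < k} = f ` {..<k}"
  using assms by auto

lemma cycle_edges_props:
  assumes "is_cycle_edges k C"
  shows "finite C" "card C = k" "finite (\<Union>C)" "card (\<Union>C) = k" "{} \<notin> C" "C \<noteq> {}"
proof -
  obtain f where k: "k \<ge> 3" and inj: "inj_on f {..<k}"
    and C: "C = {{f i, f (Suc i mod k)} | i. i < k}"
    using assms by (auto simp: is_cycle_edges_def)
  have C': "C = (\<lambda>i. {f i, f (Suc i mod k)}) ` {..<k}"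
    using C by auto
  have U: "\<Union>C = f ` {..<k}"
    unfolding C using k by (intro Union_cycle_edges) auto
  have "inj_on (\<lambda>i. {f i, f (Suc i mod k)}) {..<k}"
  proof (rule inj_onI)
    fix i j
    assume ij: "i \<in> {..<k}" "j \<in> {..<k}" "{f i, f (Suc i mod k)} = {f j, f (Suc j mod k)}"
    show "i = j"
    proof (rule ccontr)
      assume "i \<noteq> j"
      then have "f i \<noteq> f j"
        using inj ij by (auto dest: inj_onD)
      \<comment> \<open>Two indices with the same edge would be cyclic successors of each other, so
        \<open>k\<close> would divide 2.\<close>
      then have "f i = f (Suc j mod k)" "f j = f (Suc i mod k)"
        using ij(3) by (auto simp: doubleton_eq_iff)
      then have i: "i = Suc j mod k" and j: "j = Suc i mod k"
        using inj ij k by (auto dest!: inj_onD[OF inj])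
      have Suc_mod: "Suc l mod k = (if Suc l = k then 0 else Suc l)" if "l < k" for l
        using that by (simp add: mod_Suc)
      have "i = (if Suc j = k then 0 else Suc j)"
        by (rule trans[OF i Suc_mod]) (use ij in simp)
      moreover have "j = (if Suc i = k then 0 else Suc i)"
        by (rule trans[OF j Suc_mod]) (use ij in simp)
      ultimately show False
        using k by presburger
    qed
  qed
  then show "card C = k"
    unfolding C' by (simp add: card_image)
  show "card (\<Union>C) = k"
    unfolding U using inj by (simp add: card_image)
  show "finite C" "{} \<notin> C" "C \<noteq> {}"
    unfolding C' using k by (auto simp: lessThan_empty_iff)
  show "finite (\<Union>C)"
    unfolding U by simp
qed

text \<open>A cycle has as many edges as vertices, and summing over the vertex-disjoint components
  counts \<open>F\<close> on one side and \<open>V\<close> on the other.\<close>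

lemma card_ck_factor:
  assumes "ck_factor k V F" and "finite V"
  shows "card F = card V" "finite F"
proof -
  obtain \<C> where cyc: "\<And>C. C \<in> \<C> \<Longrightarrow> is_cycle_edges k C" and F: "\<Union>\<C> = F"
    and disj: "\<And>C D. C \<in> \<C> \<Longrightarrow> D \<in> \<C> \<Longrightarrow> C \<noteq> D \<Longrightarrow> \<Union>C \<inter> \<Union>D = {}" and V: "\<Union>F = V"
    using assms(1) unfolding ck_factor_def by metis
  have "F \<subseteq> Pow V"
    using V by auto
  then show fin: "finite F"
    using assms(2) by (auto intro: finite_subset)
  have disj': "C \<inter> D = {}" if "C \<in> \<C>" "D \<in> \<C>" "C \<noteq> D" for C D
  proof -
    have "e = {}" if "e \<in> C" "e \<in> D" for e
      using that disj[OF \<open>C \<in> \<C>\<close> \<open>D \<in> \<C>\<close> \<open>C \<noteq> D\<close>] by blast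
    then show ?thesis
      using cycle_edges_props(5)[OF cyc[OF that(1)]] by blast
  qed
  have "card F = (\<Sum>C\<in>\<C>. card C)"
    unfolding F[symmetric]
    by (rule card_Union_disjoint) (auto simp: pairwise_def disjnt_def disj' dest: cyc intro: cycle_edges_props)
  also have "\<dots> = (\<Sum>C\<in>\<C>. card (\<Union>C))"
    by (rule sum.cong) (auto dest!: cyc simp: cycle_edges_props)
  also have "\<dots> = card (\<Union>C\<in>\<C>. \<Union>C)"
  proof (rule card_UN_disjoint[symmetric])
    show "finite \<C>"
      using fin F finite_UnionD by blast
    show "\<forall>C\<in>\<C>. finite (\<Union>C)"
      using cyc cycle_edges_props(3) by blast
    show "\<forall>C\<in>\<C>. \<forall>D\<in>\<C>. C \<noteq> D \<longrightarrow> \<Union>C \<inter> \<Union>D = {}"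
      using disj by blast
  qed
  also have "(\<Union>C\<in>\<C>. \<Union>C) = V"
    using F V by auto
  finally show "card F = card V" .
qed

lemma card_complete_edges:
  assumes "finite V"
  shows "card (complete_edges V) = card V choose 2"
proof -
  have "complete_edges V = {B. B \<subseteq> V \<and> card B = 2}"
    unfolding complete_edges_def card_2_iff by auto
  then show ?thesis
    using assms by (simp add: n_subsets)
qed

lemma finite_complete_edges: "finite V \<Longrightarrow> finite (complete_edges V)"
  by (rule finite_subset[of _ "Pow V"]) (auto simp: complete_edges_def)

lemma card_perfect_matching:
  assumes "perfect_matching V I" and "finite V"
  shows "2 * card I = card V"
proof -
  have sub: "I \<subseteq> complete_edges V" and ex: "\<And>v. v \<in> V \<Longrightarrow> \<exists>!e. e \<in> I \<and> v \<in> e"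
    using assms(1) unfolding perfect_matching_def by auto
  have e: "card e = 2" "finite e" "e \<subseteq> V" if "e \<in> I" for e
    using sub that by (auto simp: complete_edges_def)
  have "card V = card (\<Union>I)"
    using ex e by (intro arg_cong[of _ _ card]) blast
  also have "\<dots> = (\<Sum>e\<in>I. card e)"
  proof (rule card_Union_disjoint)
    show "pairwise disjnt I"
      unfolding pairwise_def disjnt_iff using ex e(3) by blast
  qed (use e in auto)
  also have "\<dots> = 2 * card I"
    by (simp add: e(1))
  finally show ?thesis
    by simp
qed

lemma card_UN_ck_factors:
  assumes "finite V"
    and "\<And>i. i < n \<Longrightarrow> \<exists>k. ck_factor k V (F i)"
    and "\<And>i j. i < n \<Longrightarrow> j < n \<Longrightarrow> i \<noteq> j \<Longrightarrow> F i \<inter> F j = {}"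
  shows "card (\<Union>i<n. F i) = n * card V"
proof -
  have F: "finite (F i)" "card (F i) = card V" if "i < n" for i
    using assms(1,2) that card_ck_factor by blast+
  have "card (\<Union>i<n. F i) = (\<Sum>i<n. card (F i))"
    by (rule card_UN_disjoint) (use F assms(3) in auto)
  then show ?thesis
    by (simp add: F)
qed

text \<open>The value is 1128 - 24 = 23 * 48. It forces \<open>r + s = 23\<close>, and conversely
  makes 23 disjoint factors that avoid the matching exhaust all other edges.\<close>

lemma card_complete_minus_matching_48:
  assumes "perfect_matching {..<48::nat} I"
  shows "card (complete_edges {..<48} - I) = 1104"
proof -
  have I: "I \<subseteq> complete_edges {..<48}"
    using assms by (simp add: perfect_matching_def)
  then have "finite I"
    by (rule finite_subset) (simp add: finite_complete_edges)
  then show ?thesis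
    using card_perfect_matching[OF assms] card_complete_edges[of "{..<48::nat}"] I
    by (simp add: card_Diff_subset choose_two)
qed

section \<open>Packings in prescribed edge classes\<close>

text \<open>
  The class of the edge \<open>{u, v}\<close> with \<open>u < v\<close>: 0 for the matching, 1 for the four copies of
  \<open>K\<^sub>1\<^sub>2 - I\<close>, 2 for the columns, and 3, 4, 5 for the parallel classes of the transversal design over
  the field with four elements. The coordinates \<open>g = 0, 3, 1, 2\<close> stand for \<open>0, 1, \<omega>, \<omega>\<^sup>2\<close>, so that addition
  is bitwise exclusive or. The block \<open>{(b + \<omega>\<^sup>e \<omega>\<^sup>-\<^sup>h, h) | h < 3}\<close> is in class \<open>3 + e\<close>, and two of its points
  with second coordinates \<open>h\<close> and \<open>h'\<close> have first coordinates that differ by \<open>\<omega>\<close> to the power \<open>e + h + h'\<close>.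
\<close>

definition colour :: "nat \<Rightarrow> nat \<Rightarrow> nat" where
  "colour u v =
     (let g = u div 12; g' = v div 12; h = u mod 12 div 4; h' = v mod 12 div 4 in
      if u div 2 = v div 2 then 0
      else if g = g' then 1
      else if h = h' then 2
      else 3 + ((if g + g' = 3 then 0 else g' - g) + 2 * (h + h')) mod 3)"

definition colour_edges :: "nat set \<Rightarrow> nat set set" where
  "colour_edges S = {{u, v} | u v. u < v \<and> v < 48 \<and> colour u v \<in> S}"

text \<open>Covering is not part of this notion, since counting shows that 23 factors use up all edges.\<close>

definition packs :: "nat set \<Rightarrow> nat \<Rightarrow> nat \<Rightarrow> bool" where
  "packs S r s \<longleftrightarrow>
     (\<exists>A B. length A = r \<and> length B = s \<and>
        (\<forall>F\<in>set A. ck_factor 4 {..<48} F) \<and> (\<forall>F\<in>set B. ck_factor 3 {..<48} F) \<and>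
        sorted_wrt disjnt (A @ B) \<and> (\<forall>F\<in>set (A @ B). F \<subseteq> colour_edges S))"

lemma colour_edges_disjoint: "S \<inter> T = {} \<Longrightarrow> colour_edges S \<inter> colour_edges T = {}"
  by (auto simp: colour_edges_def doubleton_eq_iff)

lemma colour_edges_mono: "S \<subseteq> T \<Longrightarrow> colour_edges S \<subseteq> colour_edges T"
  by (auto simp: colour_edges_def)

lemma colour_edges_subset_complete: "colour_edges S \<subseteq> complete_edges {..<48}"
proof
  fix e
  assume "e \<in> colour_edges S"
  then obtain u v where "e = {u, v}" "u < v" "v < 48"
    unfolding colour_edges_def by blast
  moreover from this have "u \<in> {..<48} \<and> v \<in> {..<48} \<and> u \<noteq> v"
    by auto
  ultimately show "e \<in> complete_edges {..<48}"
    unfolding complete_edges_def by blast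
qed

lemma packs_add:
  assumes "packs S r s" and "packs T r' s'" and "S \<inter> T = {}"
  shows "packs (S \<union> T) (r + r') (s + s')"
proof -
  obtain A B where AB: "length A = r" "length B = s"
    "\<forall>F\<in>set A. ck_factor 4 {..<48} F" "\<forall>F\<in>set B. ck_factor 3 {..<48} F"
    "sorted_wrt disjnt (A @ B)" "\<forall>F\<in>set (A @ B). F \<subseteq> colour_edges S"
    using assms(1) unfolding packs_def by blast
  obtain A' B' where AB': "length A' = r'" "length B' = s'"
    "\<forall>F\<in>set A'. ck_factor 4 {..<48} F" "\<forall>F\<in>set B'. ck_factor 3 {..<48} F"
    "sorted_wrt disjnt (A' @ B')" "\<forall>F\<in>set (A' @ B'). F \<subseteq> colour_edges T"
    using assms(2) unfolding packs_def by blast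
  have "disjnt F G \<and> disjnt G F" if "F \<in> set (A @ B)" "G \<in> set (A' @ B')" for F G
    using that AB(6) AB'(6) colour_edges_disjoint[OF assms(3)] unfolding disjnt_def by blast
  then have cross: "\<forall>F\<in>set (A @ B). \<forall>G\<in>set (A' @ B'). disjnt F G \<and> disjnt G F"
    by blast
  have "sorted_wrt disjnt ((A @ A') @ (B @ B'))"
    using AB(5) AB'(5) cross unfolding sorted_wrt_append set_append ball_Un by blast
  moreover have "\<forall>F\<in>set ((A @ A') @ (B @ B')). F \<subseteq> colour_edges (S \<union> T)"
    using AB(6) AB'(6) colour_edges_mono[of S "S \<union> T"] colour_edges_mono[of T "S \<union> T"]
    unfolding set_append by blast
  ultimately show ?thesis
    unfolding packs_def using AB(1-4) AB'(1-4)
    by (intro exI[of _ "A @ A'"] exI[of _ "B @ B'"] conjI) (simp_all add: ball_Un)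
qed

section \<open>From packings to solutions: the removed matching\<close>

definition matching :: "nat set set" where
  "matching = colour_edges {0}"

lemma matching_eq: "matching = (\<lambda>k. {2 * k, 2 * k + 1}) ` {..<24}"
proof (rule set_eqI, rule iffI)
  fix e
  assume "e \<in> matching"
  then obtain u v where e: "e = {u, v}" and "u < v" "v < 48" "colour u v = 0"
    unfolding matching_def colour_edges_def by blast
  then have "u div 2 = v div 2"
    by (simp add: colour_def Let_def split: if_splits)
  with \<open>u < v\<close> have "u = 2 * (v div 2) \<and> v = 2 * (v div 2) + 1"
    by presburger
  then show "e \<in> (\<lambda>k. {2 * k, 2 * k + 1}) ` {..<24}"
    using e \<open>v < 48\<close> by (intro image_eqI[of _ _ "v div 2"]) auto
next
  fix e
  assume "e \<in> (\<lambda>k. {2 * k, 2 * k + 1}) ` {..<24::nat}"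
  then obtain k where k: "e = {2 * k, 2 * k + 1}" "k < 24"
    by blast
  moreover have "2 * k < 2 * k + 1 \<and> 2 * k + 1 < 48 \<and> colour (2 * k) (2 * k + 1) \<in> {0}"
    using k by (simp add: colour_def)
  ultimately show "e \<in> matching"
    unfolding matching_def colour_edges_def by blast
qed

lemma perfect_matching_matching: "perfect_matching {..<48} matching"
  unfolding perfect_matching_def
proof (intro conjI ballI)
  show "matching \<subseteq> complete_edges {..<48}"
    unfolding matching_def by (rule colour_edges_subset_complete)
  fix v :: nat
  assume v: "v \<in> {..<48}"
  have pair: "v \<in> {2 * k, 2 * k + 1} \<longleftrightarrow> k = v div 2" for k
    unfolding insert_iff empty_iff by presburger
  have "v div 2 < 24"
    using v by auto
  then show "\<exists>!e. e \<in> matching \<and> v \<in> e"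
    unfolding matching_eq
  proof (intro ex1I[of _ "{2 * (v div 2), 2 * (v div 2) + 1}"])
    fix e
    assume "e \<in> (\<lambda>k. {2 * k, 2 * k + 1}) ` {..<24} \<and> v \<in> e"
    then obtain k where "e = {2 * k, 2 * k + 1}" "v \<in> e"
      by blast
    then show "e = {2 * (v div 2), 2 * (v div 2) + 1}"
      using pair[of k] by simp
  qed (use pair in blast)
qed

lemma hwp43_if_packs:
  assumes "packs S r s" and "0 \<notin> S" and "r + s = 23"
  shows "hwp43 48 r s"
proof -
  obtain A B where AB: "length A = r" "length B = s"
    "\<forall>F\<in>set A. ck_factor 4 {..<48} F" "\<forall>F\<in>set B. ck_factor 3 {..<48} F"
    "sorted_wrt disjnt (A @ B)" "\<forall>F\<in>set (A @ B). F \<subseteq> colour_edges S"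
    using assms(1) unfolding packs_def by blast
  define F where "F i = (A @ B) ! i" for i
  have F4: "ck_factor 4 {..<48} (F i)" if "i < r" for i
    using that AB unfolding F_def by (auto simp: nth_append)
  have F3: "ck_factor 3 {..<48} (F i)" if "r \<le> i" "i < r + s" for i
    using that AB unfolding F_def by (auto simp: nth_append)
  have disj: "F i \<inter> F j = {}" if "i < r + s" "j < r + s" "i \<noteq> j" for i j
    using that sorted_wrt_nth_less[OF AB(5), of i j] sorted_wrt_nth_less[OF AB(5), of j i]
    unfolding F_def disjnt_def by (cases "i < j") (auto simp: AB)
  have "F i \<subseteq> colour_edges S" if "i < r + s" for i
    using that AB nth_mem[of i "A @ B"] unfolding F_def by simp
  moreover have "colour_edges S \<subseteq> complete_edges {..<48} - matching"
    using colour_edges_disjoint[of S "{0}"] colour_edges_subset_complete[of S] assms(2)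
    unfolding matching_def by blast
  ultimately have sub: "(\<Union>i<r+s. F i) \<subseteq> complete_edges {..<48} - matching"
    by blast
  have "\<exists>k. ck_factor k {..<48} (F i)" if "i < r + s" for i
    using F4[of i] F3[of i] that by (meson not_le)
  then have "card (\<Union>i<r+s. F i) = (r + s) * card {..<48::nat}"
    by (rule card_UN_ck_factors[OF finite_lessThan _ disj])
  then have "(\<Union>i<r+s. F i) = complete_edges {..<48} - matching"
    using sub card_complete_minus_matching_48[OF perfect_matching_matching] assms(3)
    by (intro card_subset_eq) (auto simp: finite_complete_edges)
  then show ?thesis
    unfolding hwp43_def using perfect_matching_matching F4 F3 disj by blast
qed

section \<open>Checking explicit packings\<close>

text \<open>Increasing pairs represent each edge uniquely, so disjointness of edge sets becomes
  distinctness of pairs; \<open>colour\<close> also expects its smaller argument first.\<close>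

definition cycle_pairs :: "nat list \<Rightarrow> (nat \<times> nat) list" where
  "cycle_pairs c = map (\<lambda>(u, v). if u < v then (u, v) else (v, u)) (zip c (rotate1 c))"

definition factor_pairs :: "nat list list \<Rightarrow> (nat \<times> nat) list" where
  "factor_pairs f = concat (map cycle_pairs f)"

definition edges_of :: "(nat \<times> nat) list \<Rightarrow> nat set set" where
  "edges_of ps = (\<lambda>(u, v). {u, v}) ` set ps"

definition factor_check :: "nat \<Rightarrow> nat list list \<Rightarrow> bool" where
  "factor_check k f \<longleftrightarrow>
     (\<forall>c\<in>set f. length c = k) \<and> distinct (concat f) \<and> length (concat f) = 48 \<and>
     (\<forall>v\<in>set (concat f). v < 48)"

text \<open>
  Unlike \<open>distinct\<close>, this needs only quasi-linearly many comparisons, by the quicksort code equation of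
  \<^theory>\<open>HOL-Library.Multiset\<close>.
\<close>

definition distinct_pairs :: "(nat \<times> nat) list \<Rightarrow> bool" where
  "distinct_pairs ps \<longleftrightarrow> successively (<) (sort (map (\<lambda>(u, v). 48 * u + v) ps))"

definition packing_check :: "nat set \<Rightarrow> nat list list list \<Rightarrow> nat list list list \<Rightarrow> bool" where
  "packing_check S A B \<longleftrightarrow>
     (\<forall>f\<in>set A. factor_check 4 f) \<and> (\<forall>f\<in>set B. factor_check 3 f) \<and>
     (let ps = concat (map factor_pairs (A @ B)) in
        distinct_pairs ps \<and> (\<forall>(u, v)\<in>set ps. u < v \<and> v < 48 \<and> colour u v \<in> S))"

lemma edges_of_cycle_pairs:
  "edges_of (cycle_pairs c) = {{c ! i, c ! (Suc i mod length c)} | i. i < length c}"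
proof -
  have "edges_of (cycle_pairs c) = (\<lambda>(u, v). {u, v}) ` set (zip c (rotate1 c))"
    unfolding edges_of_def cycle_pairs_def set_map image_image
    by (rule image_cong) (auto split: if_splits)
  also have "\<dots> = {{c ! i, c ! (Suc i mod length c)} | i. i < length c}"
    by (force simp: set_zip nth_rotate1)
  finally show ?thesis .
qed

lemma is_cycle_edges_list:
  assumes "distinct c" and "length c \<ge> 3"
  shows "is_cycle_edges (length c) (edges_of (cycle_pairs c))"
  unfolding is_cycle_edges_def edges_of_cycle_pairs
  using assms by (auto intro!: exI[of _ "(!) c"] inj_on_nth)

lemma Union_edges_of_cycle_pairs: "\<Union>(edges_of (cycle_pairs c)) = set c"
proof (cases "c = []")
  case True
  then show ?thesis
    by (simp add: edges_of_def cycle_pairs_def)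
next
  case False
  then have "\<Union>(edges_of (cycle_pairs c)) = (!) c ` {..<length c}"
    unfolding edges_of_cycle_pairs by (intro Union_cycle_edges) auto
  then show ?thesis
    by (auto simp: set_conv_nth)
qed

lemma edges_of_concat: "edges_of (concat pss) = (\<Union>ps\<in>set pss. edges_of ps)"
  by (auto simp: edges_of_def)

text \<open>48 distinct entries below 48 exhaust the vertex set, and distinctness across the whole
  concatenation keeps the cycles vertex-disjoint.\<close>

lemma factor_check_sound:
  assumes "factor_check k f" and "k \<ge> 3"
  shows "ck_factor k {..<48} (edges_of (factor_pairs f))"
proof -
  have len: "\<forall>c\<in>set f. length c = k" and dist: "distinct (concat f)"
    and len': "length (concat f) = 48" and "\<forall>v\<in>set (concat f). v < 48"
    using assms(1) unfolding factor_check_def by iprover+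
  then have sub: "set (concat f) \<subseteq> {..<48}"
    by blast
  have "card (set (concat f)) = 48"
    using distinct_card[OF dist] len' by (rule trans)
  then have all: "set (concat f) = {..<48}"
    by (rule card_subset_eq[OF finite_lessThan sub, unfolded card_lessThan])
  let ?\<C> = "(\<lambda>c. edges_of (cycle_pairs c)) ` set f"
  have U: "\<Union>?\<C> = edges_of (factor_pairs f)"
    unfolding factor_pairs_def edges_of_concat by simp
  have "\<Union>(edges_of (factor_pairs f)) = (\<Union>c\<in>set f. \<Union>(edges_of (cycle_pairs c)))"
    unfolding U[symmetric] by blast
  then have V: "\<Union>(edges_of (factor_pairs f)) = {..<48}"
    using all unfolding Union_edges_of_cycle_pairs set_concat by simp
  have cyc: "is_cycle_edges k C" if C: "C \<in> ?\<C>" for C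
  proof -
    obtain c where c: "c \<in> set f" "C = edges_of (cycle_pairs c)"
      using C by blast
    moreover have "distinct c"
      using c(1) dist unfolding distinct_concat_iff by blast
    ultimately show ?thesis
      using is_cycle_edges_list[of c] len assms(2) by simp
  qed
  have disj: "\<Union>C \<inter> \<Union>D = {}" if CD: "C \<in> ?\<C>" "D \<in> ?\<C>" "C \<noteq> D" for C D
  proof -
    obtain c d where c: "c \<in> set f" "C = edges_of (cycle_pairs c)"
      and d: "d \<in> set f" "D = edges_of (cycle_pairs d)"
      using CD by blast
    then have "c \<noteq> d"
      using CD(3) by blast
    then show ?thesis
      using c(1) d(1) dist unfolding c(2) d(2) Union_edges_of_cycle_pairs distinct_concat_iff by blast
  qed
  show ?thesis
    unfolding ck_factor_def
  proof (intro exI[of _ ?\<C>] conjI ballI impI)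
    show "is_cycle_edges k C" if "C \<in> ?\<C>" for C
      using that by (rule cyc)
    show "\<Union>C \<inter> \<Union>D = {}" if "C \<in> ?\<C>" "D \<in> ?\<C>" "C \<noteq> D" for C D
      using that by (rule disj)
  qed (fact U V)+
qed

lemma sorted_wrt_edges_of:
  assumes "distinct (concat pss)" and "\<forall>(u, v)\<in>set (concat pss). u < v"
  shows "sorted_wrt disjnt (map edges_of pss)"
  using assms
proof (induction pss)
  case (Cons ps pss)
  have dist: "set ps \<inter> set (concat pss) = {}" "distinct (concat pss)"
    using Cons.prems(1) unfolding concat.simps distinct_append by blast+
  have "disjnt (edges_of ps) (edges_of qs)" if qs: "qs \<in> set pss" for qs
  proof -
    have sub: "set qs \<subseteq> set (concat pss)"
      using qs by auto
    have "e \<notin> edges_of qs" if "e \<in> edges_of ps" for e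
    proof
      assume "e \<in> edges_of qs"
      then obtain u v u' v' where e: "e = {u, v}" "(u, v) \<in> set ps" "e = {u', v'}" "(u', v') \<in> set qs"
        using \<open>e \<in> edges_of ps\<close> by (auto simp: edges_of_def)
      then have "u < v" "u' < v'"
        using Cons.prems(2) sub by auto
      then have "(u, v) = (u', v')"
        using e(1,3) by (auto simp: doubleton_eq_iff)
      then show False
        using e(2,4) dist(1) sub by blast
    qed
    then show ?thesis
      unfolding disjnt_iff by blast
  qed
  moreover have "sorted_wrt disjnt (map edges_of pss)"
    using Cons.IH[OF dist(2)] Cons.prems(2) by simp
  ultimately show ?case
    by simp
qed simp

text \<open>A strictly increasing list has no repetition, and elements with different images under a
  map are different.\<close>

lemma distinct_if_distinct_pairs:
  assumes "distinct_pairs ps"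
  shows "distinct ps"
proof -
  have "sorted_wrt (<) (sort (map (\<lambda>(u, v). 48 * u + v) ps))"
    using assms by (simp add: distinct_pairs_def successively_iff_sorted_wrt_strong)
  then have "distinct (map (\<lambda>(u, v). 48 * u + v) ps)"
    by (simp add: strict_sorted_iff)
  then show ?thesis
    by (simp add: distinct_map)
qed

lemma packs_if_check:
  assumes "packing_check S A B" and "length A = r" and "length B = s"
  shows "packs S r s"
proof -
  have A: "\<forall>f\<in>set A. factor_check 4 f" and B: "\<forall>f\<in>set B. factor_check 3 f"
    and dist: "distinct (concat (map factor_pairs (A @ B)))"
    and col: "\<forall>(u, v)\<in>set (concat (map factor_pairs (A @ B))). u < v \<and> v < 48 \<and> colour u v \<in> S"
    using assms(1) distinct_if_distinct_pairs unfolding packing_check_def Let_def by blast+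
  have "sorted_wrt disjnt (map edges_of (map factor_pairs (A @ B)))"
    using dist col by (intro sorted_wrt_edges_of) auto
  moreover have "edges_of (factor_pairs f) \<subseteq> colour_edges S" if "f \<in> set (A @ B)" for f
  proof
    fix e
    assume "e \<in> edges_of (factor_pairs f)"
    then obtain u v where "e = {u, v}" "(u, v) \<in> set (factor_pairs f)"
      by (auto simp: edges_of_def)
    moreover from this have "u < v \<and> v < 48 \<and> colour u v \<in> S"
      using col that by auto
    ultimately show "e \<in> colour_edges S"
      unfolding colour_edges_def by blast
  qed
  ultimately show ?thesis
    unfolding packs_def using A B assms(2,3)
    by (intro exI[of _ "map (edges_of \<circ> factor_pairs) A"] exI[of _ "map (edges_of \<circ> factor_pairs) B"])
      (auto intro: factor_check_sound)
qed

section \<open>The explicit packings\<close>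

text \<open>A factor on the 12 points \<open>x = 4 * h + y\<close> is laid over each block
  \<open>b\<close>, whose entry \<open>b ! h\<close> supplies the coordinate \<open>g\<close>.
  Constant blocks (\<open>rows\<close>) give the copies of \<open>K\<^sub>1\<^sub>2\<close>, the
  lists in \<open>blocks\<close> the copies of
  \<open>K\<^sub>4\<^sub>,\<^sub>4\<^sub>,\<^sub>4\<close>.\<close>

definition copies :: "nat list list \<Rightarrow> nat list list \<Rightarrow> nat list list" where
  "copies bs f = concat (map (\<lambda>b. map (map (\<lambda>x. 12 * b ! (x div 4) + x)) f) bs)"

definition rows :: "nat list list" where
  "rows = [[0,0,0], [1,1,1], [2,2,2], [3,3,3]]"

section \<open>Factorizations of \<open>K\<^sub>1\<^sub>2 - I\<close> and of the columns\<close>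

lemma packs_K12_1: "packs {1} 1 4"
proof -
  have "packing_check {1}
    (map (copies rows)
      [[[0,10,1,11],[2,8,3,9],[4,6,5,7]]])
    (map (copies rows)
      [[[0,8,5],[2,1,7],[4,9,11],[6,10,3]],
       [[0,2,4],[3,5,11],[6,8,1],[10,7,9]],
       [[0,3,7],[1,5,9],[2,6,11],[4,8,10]],
       [[0,6,9],[2,10,5],[4,1,3],[8,7,11]]])"
    by code_simp
  then show ?thesis
    by (rule packs_if_check) simp_all
qed

lemma packs_K12_2: "packs {1} 2 3"
proof -
  have "packing_check {1}
    (map (copies rows)
      [[[0,3,8,11],[2,6,9,10],[4,1,5,7]],
       [[0,6,1,9],[2,8,7,11],[4,10,5,3]]])
    (map (copies rows)
      [[[0,8,5],[2,1,7],[4,9,11],[6,10,3]],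
       [[0,2,4],[3,7,9],[6,5,11],[8,10,1]],
       [[0,10,7],[1,3,11],[2,5,9],[4,6,8]]])"
    by code_simp
  then show ?thesis
    by (rule packs_if_check) simp_all
qed

lemma packs_K12_3: "packs {1} 3 2"
proof -
  have "packing_check {1}
    (map (copies rows)
      [[[0,2,7,8],[4,3,10,9],[6,1,11,5]],
       [[0,4,11,6],[2,10,7,9],[8,3,1,5]],
       [[0,3,11,7],[2,1,9,5],[4,8,6,10]]])
    (map (copies rows)
      [[[0,9,11],[2,4,6],[3,5,7],[8,10,1]],
       [[0,10,5],[2,8,11],[4,1,7],[6,3,9]]])"
    by code_simp
  then show ?thesis
    by (rule packs_if_check) simp_all
qed

lemma packs_K12_4: "packs {1} 4 1"
proof -
  have "packing_check {1}
    (map (copies rows)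
      [[[0,2,9,7],[4,6,5,10],[8,3,1,11]],
       [[0,6,1,9],[2,4,8,10],[3,5,11,7]],
       [[0,4,3,11],[2,6,9,5],[8,1,10,7]],
       [[0,10,9,3],[2,8,6,11],[4,1,5,7]]])
    (map (copies rows)
      [[[0,8,5],[2,1,7],[4,9,11],[6,10,3]]])"
    by code_simp
  then show ?thesis
    by (rule packs_if_check) simp_all
qed

lemma packs_K12_5: "packs {1} 5 0"
proof -
  have "packing_check {1}
    (map (copies rows)
      [[[0,8,2,5],[1,3,11,7],[4,10,6,9]],
       [[0,6,1,10],[2,9,5,11],[4,3,8,7]],
       [[0,7,3,9],[2,4,11,1],[6,8,10,5]],
       [[0,3,6,11],[2,10,9,7],[4,8,5,1]],
       [[0,2,6,4],[8,1,9,11],[10,3,5,7]]])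
    (map (copies rows)
      [])"
    by code_simp
  then show ?thesis
    by (rule packs_if_check) simp_all
qed

lemma packs_K12:
  assumes "1 \<le> r" and "r \<le> 5"
  shows "packs {1} r (5 - r)"
proof -
  have "r \<in> {1, 2, 3, 4, 5}"
    using assms by auto
  then show ?thesis
    using packs_K12_1 packs_K12_2 packs_K12_3 packs_K12_4 packs_K12_5 by auto
qed

text \<open>In a column, each of the three perfect matchings of the four values of \<open>g\<close>
  yields two disjoint \<open>K\<^sub>4\<^sub>,\<^sub>4\<close>, and each of these splits into two
  \<open>C\<^sub>4\<close>-factors.\<close>

lemma packs_columns: "packs {2} 6 0"
proof -
  have "packing_check {2}
    (map (\<lambda>f. concat (map (\<lambda>h. map (map (\<lambda>v. v + 4 * h)) f) [0,1,2]))
      [[[0,12,1,13],[2,14,3,15],[24,36,25,37],[26,38,27,39]],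
       [[0,14,1,15],[2,12,3,13],[24,38,25,39],[26,36,27,37]],
       [[0,24,1,25],[2,26,3,27],[12,36,13,37],[14,38,15,39]],
       [[0,26,1,27],[2,24,3,25],[12,38,13,39],[14,36,15,37]],
       [[0,36,1,37],[2,38,3,39],[12,24,13,25],[14,26,15,27]],
       [[0,38,1,39],[2,36,3,37],[12,26,13,27],[14,24,15,25]]])
    []"
    by code_simp
  then show ?thesis
    by (rule packs_if_check) simp_all
qed

text \<open>\<open>blocks ! e\<close> lists the blocks of class \<open>3 + e\<close> from the
  description of \<open>colour\<close>, sorted by first entry; entry \<open>h\<close> of a block is
  the coordinate \<open>g\<close> of its point in column \<open>h\<close>.\<close>

definition blocks :: "nat list list list" where
  "blocks = [[[0,1,2],[1,0,3],[2,3,0],[3,2,1]],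
             [[0,2,3],[1,3,2],[2,0,1],[3,1,0]],
             [[0,3,1],[1,2,0],[2,1,3],[3,0,2]]]"

text \<open>The 16 triangles in \<open>K\<^sub>4\<^sub>,\<^sub>4\<^sub>,\<^sub>4\<close> are the
  cells of a Latin square of order 4, and the four factors are disjoint transversals of it.\<close>

lemma packs_class_0:
  assumes "i < 3"
  shows "packs {3 + i} 0 4"
proof -
  have check: "\<forall>i\<in>set [0,1,2]. packing_check {3 + i}
    (map (copies (blocks ! i))
      [])
    (map (copies (blocks ! i))
      [[[0,6,11],[1,4,10],[2,7,8],[3,5,9]],
       [[0,4,9],[1,6,8],[2,5,10],[3,7,11]],
       [[0,7,10],[1,5,11],[2,6,9],[3,4,8]],
       [[0,5,8],[1,7,9],[2,4,11],[3,6,10]]])"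
    by code_simp
  have "i \<in> set [0,1,2]"
    using assms by auto
  from bspec[OF check this] show ?thesis
    by (rule packs_if_check) simp_all
qed

text \<open>Pairing the points \<open>2 * k\<close> and \<open>2 * k + 1\<close> turns
  \<open>K\<^sub>4\<^sub>,\<^sub>4\<^sub>,\<^sub>4\<close> into a doubled octahedron. Each of the
  four perfect matchings in a 1-factorization of the octahedron gives a
  \<open>C\<^sub>4\<close>-factor, as a doubled edge is a 4-cycle.\<close>

lemma packs_class_4:
  assumes "i < 3"
  shows "packs {3 + i} 4 0"
proof -
  have check: "\<forall>i\<in>set [0,1,2]. packing_check {3 + i}
    (map (copies (blocks ! i))
      [[[0,4,1,5],[2,8,3,9],[6,10,7,11]],
       [[0,6,1,7],[2,10,3,11],[4,8,5,9]],
       [[0,8,1,9],[2,6,3,7],[4,10,5,11]],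
       [[0,10,1,11],[2,4,3,5],[6,8,7,9]]])
    (map (copies (blocks ! i))
      [])"
    by code_simp
  have "i \<in> set [0,1,2]"
    using assms by auto
  from bspec[OF check this] show ?thesis
    by (rule packs_if_check) simp_all
qed

lemma packs_classes:
  assumes "j \<le> 3"
  shows "packs ({3 + 0} \<union> {3 + 1} \<union> {3 + 2}) (4 * j) (12 - 4 * j)"
proof -
  have cls: "packs {3 + i} (4 * m) (4 - 4 * m)" if "i < 3" "m \<le> 1" for i m
    using packs_class_0[OF that(1)] packs_class_4[OF that(1)] that(2) by (cases m) auto
  \<comment> \<open>With truncated subtraction these are 0 or 1 and add up to \<open>j\<close>: the
    first \<open>j\<close> classes are split into 4-cycles, the others into triangles.\<close>
  define a b c where "a = min 1 j" and "b = min 1 (j - 1)" and "c = j - 2"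
  note abc = this
  have "packs ({3 + 0} \<union> {3 + 1} \<union> {3 + 2}) (4 * a + 4 * b + 4 * c)
      ((4 - 4 * a) + (4 - 4 * b) + (4 - 4 * c))"
    by (intro packs_add cls) (use assms in \<open>simp_all add: abc\<close>)
  moreover have "4 * a + 4 * b + 4 * c = 4 * j"
    and "(4 - 4 * a) + (4 - 4 * b) + (4 - 4 * c) = 12 - 4 * j"
    using assms unfolding abc by auto
  ultimately show ?thesis
    by simp
qed

text \<open>
  For the multipartite graph of type \<open>12\<^sup>4\<close>, the cyclic group of order 12 rotates all parts and
  \<open>turn\<close> fixes one part and permutes the other three. The eight starter triangles meet every part
  once in each residue class modulo 6, and their edges represent every orbit of edges exactly once.
\<close>

definition rotate_parts :: "nat \<Rightarrow> nat \<Rightarrow> nat" where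
  "rotate_parts t v = 12 * (v div 12) + (v + t) mod 12"

definition turn :: "nat \<Rightarrow> nat" where
  "turn v = 12 * [0,2,3,1] ! (v div 12) + v mod 12"

definition starters :: "nat list list" where
  "starters = [[17, 27, 41], [3, 34, 37], [1, 16, 24], [2, 19, 46], [4, 20, 25], [5, 29, 42], [0, 18, 38], [15, 26, 45]]"

text \<open>Adding the translates by 6 makes the starters cover each vertex once. The shifts
  \<open>t < 6\<close> and the powers of \<open>turn\<close> then complete the action of the group
  of order 36, which reaches each of the 24 * 36 edges once.\<close>

definition triangle_factors :: "nat list list list" where
  "triangle_factors =
     [map (map (rotate_parts t)) (ts @ map (map (rotate_parts 6)) ts).
        ts \<leftarrow> [starters, map (map turn) starters, map (map (turn \<circ> turn)) starters],
        t \<leftarrow> [0,1,2,3,4,5]]"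

lemma packs_multipartite: "packs {2,3,4,5} 0 18"
proof -
  have "packing_check {2,3,4,5} [] triangle_factors"
    by code_simp
  then show ?thesis
    by (rule packs_if_check) (simp_all add: triangle_factors_def)
qed

section \<open>The main theorem\<close>

lemma hwp43_48_imp_sum:
  assumes "hwp43 48 r s"
  shows "r + s = 23"
proof -
  obtain I :: "nat set set" and F where I: "perfect_matching {..<48} I"
    and F4: "\<forall>i<r. ck_factor 4 {..<48} (F i)"
    and F3: "\<forall>i. r \<le> i \<and> i < r + s \<longrightarrow> ck_factor 3 {..<48} (F i)"
    and disjoint: "\<forall>i<r+s. \<forall>j<r+s. i \<noteq> j \<longrightarrow> F i \<inter> F j = {}"
    and U: "(\<Union>i<r+s. F i) = complete_edges {..<48} - I"
    using assms unfolding hwp43_def by (elim exE conjE) (rule that)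
  have disj: "F i \<inter> F j = {}" if "i < r + s" "j < r + s" "i \<noteq> j" for i j
    using disjoint that by blast
  have "\<exists>k. ck_factor k {..<48} (F i)" if "i < r + s" for i
    using F4[rule_format, of i] F3[rule_format, of i] that by (meson not_le)
  then have "card (\<Union>i<r+s. F i) = (r + s) * card {..<48::nat}"
    by (rule card_UN_ck_factors[OF finite_lessThan _ disj])
  then show ?thesis
    using card_complete_minus_matching_48[OF I] U by simp
qed

theorem mainTheorem9:
  fixes r s :: nat
  assumes "r > 0" and "r \<noteq> 6"
  shows "hwp43 48 r s \<longleftrightarrow> r + s = 23"
proof
  assume rs: "r + s = 23"
  show "hwp43 48 r s"
  proof (cases "r \<le> 5")
    case True
    have "packs ({1} \<union> {2,3,4,5}) (r + 0) (5 - r + 18)"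
      by (rule packs_add[OF packs_K12 packs_multipartite]) (use assms True in auto)
    moreover have "5 - r + 18 = s"
      using rs True by simp
    ultimately have "packs ({1} \<union> {2,3,4,5}) r s"
      by simp
    then show ?thesis
      by (rule hwp43_if_packs) (use rs in auto)
  next
    case False
    \<comment> \<open>The offset 8 puts \<open>r0\<close> in 2..5 for \<open>r \<ge> 8\<close> and
      keeps \<open>j \<le> 3\<close> up to \<open>r = 23\<close>; for \<open>r = 7\<close>
      truncation gives \<open>j = 0\<close> and \<open>r0 = 1\<close>.\<close>
    define j where "j = (r - 8) div 4"
    define r0 where "r0 = r - 6 - 4 * j"
    have j: "j \<le> 3"
      using rs unfolding j_def by simp
    have "4 * j \<le> r - 8" "r - 8 < 4 * j + 4"
      unfolding j_def by linarith+
    then have r0: "1 \<le> r0" "r0 \<le> 5" and r: "r = r0 + 6 + 4 * j"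
      using False assms unfolding r0_def by linarith+
    have "packs ({1} \<union> {2} \<union> ({3 + 0} \<union> {3 + 1} \<union> {3 + 2}))
        (r0 + 6 + 4 * j) (5 - r0 + 0 + (12 - 4 * j))"
      by (intro packs_add packs_K12 packs_columns packs_classes) (use r0 j in simp_all)
    moreover have "5 - r0 + 0 + (12 - 4 * j) = s"
      using r0 j r rs by simp
    ultimately have "packs ({1} \<union> {2} \<union> ({3 + 0} \<union> {3 + 1} \<union> {3 + 2})) r s"
      using r by simp
    then show ?thesis
      by (rule hwp43_if_packs) (use rs in auto)
  qed
qed (rule hwp43_48_imp_sum)

end
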